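(* Let $E=\mathbb R/\mathbb Z$, let $C\in L^2(E\times E)$ be a covariance surface with Fourier expansion $C(s,t)=\sum_{j,k\in\mathbb Z}\widehat c_{jk}e^{2\pi i(js+kt)}$, and for $q\ge1$ let $A_q=\|(I-\Pi_q)C\|_{L^2}^2$. Then for every $q\ge1$ $$A_q=\sum_{j+k\notin q\mathbb Z}|\widehat c_{jk}|^2,$$ and consequently: (i) $A_1=0$, and $A_q\le A_{q'}$ whenever $q\mid q'$; (ii) $A_q=0$ if and only if $C$ is $G_q$-invariant; (iii) $A_q\uparrow A_\infty:=\sum_{j+k\ne0}|\widehat c_{jk}|^2$ as $q\to\infty$ (convergence, with monotonicity along divisibility), and $A_\infty=0$ if and only if $C$ is stationary.
   Context: $E$ carries Lebesgue measure. $\Pi_qF(s,t)=q^{-1}\sum_{\ell=0}^{q-1}F(s+\ell/q,t+\ell/q)$. $C$ is $G_q$-invariant if $C(s+\ell/q,t+\ell/q)=C(s,t)$ for all $\ell$ (a.e.). $C$ is stationary if $C(s,t)$ depends only on $t-s$ (a.e.). *)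

theory Defs
  imports "HOL-Analysis.Analysis"
begin

text \<open>A function on the circle \<open>E = \<real>/\<int>\<close> is a 1-periodic function on the reals, so that translations
  need no reduction modulo 1.  Integrals and almost-everywhere statements refer to the
  fundamental domain \<open>[0,1)\<close>.\<close>

definition circle :: "real measure" where
  "circle = restrict_space lborel {0..<1}"

definition torus :: "(real \<times> real) measure" where
  "torus = circle \<Otimes>\<^sub>M circle"

definition circle_periodic :: "(real \<Rightarrow> 'a) \<Rightarrow> bool" where
  "circle_periodic g \<longleftrightarrow> (\<forall>u. g (u + 1) = g u)"

definition torus_periodic :: "(real \<times> real \<Rightarrow> 'a) \<Rightarrow> bool" where
  "torus_periodic F \<longleftrightarrow> (\<forall>s t. F (s + 1, t) = F (s, t) \<and> F (s, t + 1) = F (s, t))"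

definition in_L2 :: "'a measure \<Rightarrow> ('a \<Rightarrow> real) \<Rightarrow> bool" where
  "in_L2 M f \<longleftrightarrow> f \<in> borel_measurable M \<and> integrable M (\<lambda>x. (f x)\<^sup>2)"

definition L2_norm :: "'a measure \<Rightarrow> ('a \<Rightarrow> real) \<Rightarrow> real" where
  "L2_norm M f = sqrt (\<integral>x. (f x)\<^sup>2 \<partial>M)"

text \<open>Elements of \<open>L\<^sup>2\<close> are only determined almost everywhere, so symmetry and positive
  semidefiniteness are those of the integral operator with kernel \<open>C\<close>.\<close>

definition covariance_surface :: "(real \<times> real \<Rightarrow> real) \<Rightarrow> bool" where
  "covariance_surface C \<longleftrightarrow>
     torus_periodic C \<and> in_L2 torus C \<and>
     (AE (s, t) in torus. C (s, t) = C (t, s)) \<and>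
     (\<forall>f. in_L2 circle f \<longrightarrow> 0 \<le> (\<integral>(s, t). C (s, t) * f s * f t \<partial>torus))"

definition fourier_coeff :: "(real \<times> real \<Rightarrow> real) \<Rightarrow> int \<Rightarrow> int \<Rightarrow> complex" where
  "fourier_coeff C j k =
     (\<integral>(s, t). complex_of_real (C (s, t)) *
        exp (- (2 * complex_of_real pi * \<i> * complex_of_real (of_int j * s + of_int k * t))) \<partial>torus)"

definition diag_average :: "nat \<Rightarrow> (real \<times> real \<Rightarrow> real) \<Rightarrow> real \<times> real \<Rightarrow> real" where
  "diag_average q F = (\<lambda>(s, t). (\<Sum>l<q. F (s + real l / real q, t + real l / real q)) / real q)"

definition asymmetry :: "(real \<times> real \<Rightarrow> real) \<Rightarrow> nat \<Rightarrow> real" where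
  "asymmetry C q = (L2_norm torus (\<lambda>x. C x - diag_average q C x))\<^sup>2"

definition asymmetry_limit :: "(real \<times> real \<Rightarrow> real) \<Rightarrow> real" where
  "asymmetry_limit C = (\<Sum>\<^sub>\<infinity>(j, k)\<in>{(j, k). j + k \<noteq> 0}. (cmod (fourier_coeff C j k))\<^sup>2)"

definition G_invariant :: "nat \<Rightarrow> (real \<times> real \<Rightarrow> real) \<Rightarrow> bool" where
  "G_invariant q C \<longleftrightarrow>
     (\<forall>l::int. AE (s, t) in torus.
        C (s + of_int l / real q, t + of_int l / real q) = C (s, t))"

definition stationary :: "(real \<times> real \<Rightarrow> real) \<Rightarrow> bool" where
  "stationary C \<longleftrightarrow>
     (\<exists>g \<in> borel_measurable borel. circle_periodic g \<and>
        (AE (s, t) in torus. C (s, t) = g (t - s)))"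

end

theory Submission
  imports Defs "HOL-Complex_Analysis.Cauchy_Integral_Theorem"
begin

text \<open>
  Parseval's identity on the torus follows from orthonormality of the characters and density of
  trigonometric polynomials; the latter comes from embedding the torus in \<open>\<complex> \<times> \<complex>\<close>, where polynomials
  are dense in \<open>L\<^sup>2\<close> of every finite Borel measure carried by a compact set (Stone--Weierstrass).
  A rotation multiplies each Fourier coefficient by a character value, so averaging over the
  diagonal rotations by \<open>l/q\<close> keeps exactly the coefficients with \<open>q\<close> dividing \<open>j + k\<close>.
  If only the coefficients with \<open>j + k = 0\<close> survive, then in the coordinates \<open>(s, t - s)\<close> the surface has the same
  coefficients as its average over \<open>s\<close>, which is a function of the lag alone.  Conversely, a
  stationary surface is invariant under every diagonal rotation, so all asymmetries and hence
  their limit vanish.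
\<close>

subsection \<open>Density of polynomials in \<open>L\<^sup>2\<close>\<close>

lemma in_L2_cmult:
  assumes "in_L2 M f" shows "in_L2 M (\<lambda>x. c * f x)"
  using assms by (auto simp: in_L2_def power_mult_distrib)

lemma square_add_le: "(x + y)\<^sup>2 \<le> 2 * x\<^sup>2 + 2 * y\<^sup>2" for x y :: real
  using sum_squares_bound[of x y] by (simp add: power2_sum)

text \<open>Over a finite measure this places \<open>L^2\<close> inside \<open>L^1\<close>; it
  yields integrability of the Fourier integrands and of the fibres of \<open>C\<close>.\<close>

lemma abs_le_one_plus_square: "\<bar>x\<bar> \<le> 1 + x\<^sup>2" for x :: real
  using zero_le_power2[of "\<bar>x\<bar> - 1"] unfolding power2_diff power2_abs by simp

lemma in_L2_add:
  assumes "in_L2 M f" "in_L2 M g" shows "in_L2 M (\<lambda>x. f x + g x)"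
proof -
  have [measurable]: "f \<in> borel_measurable M" "g \<in> borel_measurable M"
    using assms by (auto simp: in_L2_def)
  have "integrable M (\<lambda>x. 2 * (f x)\<^sup>2 + 2 * (g x)\<^sup>2)"
    using assms by (auto simp: in_L2_def)
  then have "integrable M (\<lambda>x. (f x + g x)\<^sup>2)"
    by (rule Bochner_Integration.integrable_bound) (auto intro!: AE_I2 order_trans[OF square_add_le])
  then show ?thesis by (simp add: in_L2_def)
qed

lemma in_L2_diff:
  assumes "in_L2 M f" "in_L2 M g" shows "in_L2 M (\<lambda>x. f x - g x)"
  using in_L2_add[OF assms(1) in_L2_cmult[OF assms(2), of "-1"]] by simp

lemma in_L2_sum:
  assumes "\<And>i. i \<in> I \<Longrightarrow> in_L2 M (f i)" shows "in_L2 M (\<lambda>x. \<Sum>i\<in>I. f i x)"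
  using assms
proof (induction I rule: infinite_finite_induct)
  case (insert i I)
  then show ?case using in_L2_add[of M "f i" "\<lambda>x. \<Sum>i\<in>I. f i x"] by auto
qed (auto simp: in_L2_def)

lemma integral_square_add_le:
  assumes "in_L2 M f" "in_L2 M g"
  shows "(\<integral>x. (f x + g x)\<^sup>2 \<partial>M) \<le> 2 * (\<integral>x. (f x)\<^sup>2 \<partial>M) + 2 * (\<integral>x. (g x)\<^sup>2 \<partial>M)"
proof -
  have "(\<integral>x. (f x + g x)\<^sup>2 \<partial>M) \<le> (\<integral>x. 2 * (f x)\<^sup>2 + 2 * (g x)\<^sup>2 \<partial>M)"
    using assms in_L2_add[OF assms]
    by (intro integral_mono square_add_le) (auto simp: in_L2_def)
  then show ?thesis using assms by (simp add: in_L2_def)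
qed

lemma (in finite_measure) in_L2_AE_bounded:
  assumes "f \<in> borel_measurable M" "AE x in M. \<bar>f x\<bar> \<le> B"
  shows "in_L2 M f"
proof -
  have "AE x in M. norm ((f x)\<^sup>2) \<le> B\<^sup>2"
    using assms(2) by eventually_elim (auto intro: power2_le_imp_le simp: abs_le_square_iff[symmetric])
  then show ?thesis using assms(1) by (auto simp: in_L2_def intro!: integrable_const_bound)
qed

text \<open>Requiring \<open>in_L2 M p\<close> keeps the error bound meaningful, since the Bochner
  integral of a non-integrable function is 0.\<close>

definition polynomially_approximable :: "'a::real_normed_vector measure \<Rightarrow> ('a \<Rightarrow> real) \<Rightarrow> bool" where
  "polynomially_approximable M f \<longleftrightarrow> in_L2 M f \<and>
     (\<forall>e>0. \<exists>p. real_polynomial_function p \<and> in_L2 M p \<and> (\<integral>x. (f x - p x)\<^sup>2 \<partial>M) < e)"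

text \<open>Two successive approximations, of \<open>f\<close> by \<open>g\<close> and of
  \<open>g\<close> by a polynomial, compose. Later limits can therefore run through approximable
  functions.\<close>

lemma polynomially_approximable_closure:
  assumes f: "in_L2 M f"
    and g: "\<And>e. e > 0 \<Longrightarrow> \<exists>g. polynomially_approximable M g \<and> (\<integral>x. (f x - g x)\<^sup>2 \<partial>M) < e"
  shows "polynomially_approximable M f"
  unfolding polynomially_approximable_def
proof (intro conjI f allI impI)
  fix e :: real assume "e > 0"
  \<comment> \<open>The bound \<open>integral_square_add_le\<close> doubles each error, so two
    errors below \<open>e / 4\<close> stay below \<open>e\<close> together.\<close>
  then have e: "e / 4 > 0" by simp
  obtain g where g: "polynomially_approximable M g" "(\<integral>x. (f x - g x)\<^sup>2 \<partial>M) < e / 4"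
    using g[OF e] by auto
  obtain p where p: "real_polynomial_function p" "in_L2 M p" "(\<integral>x. (g x - p x)\<^sup>2 \<partial>M) < e / 4"
    using g(1) e unfolding polynomially_approximable_def by blast
  have "in_L2 M g" using g(1) by (simp add: polynomially_approximable_def)
  from integral_square_add_le[OF in_L2_diff[OF f this] in_L2_diff[OF this p(2)]]
  have "(\<integral>x. (f x - p x)\<^sup>2 \<partial>M) < e" using g(2) p(3) by simp
  with p show "\<exists>p. real_polynomial_function p \<and> in_L2 M p \<and> (\<integral>x. (f x - p x)\<^sup>2 \<partial>M) < e" by blast
qed

lemma polynomially_approximable_add:
  assumes f: "polynomially_approximable M f" and g: "polynomially_approximable M g"
  shows "polynomially_approximable M (\<lambda>x. f x + g x)"
  unfolding polynomially_approximable_def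
proof (intro conjI allI impI)
  have L2: "in_L2 M f" "in_L2 M g" using f g by (auto simp: polynomially_approximable_def)
  then show "in_L2 M (\<lambda>x. f x + g x)" by (rule in_L2_add)
  fix e :: real assume "e > 0"
  then have e: "e / 4 > 0" by simp
  obtain p where p: "real_polynomial_function p" "in_L2 M p" "(\<integral>x. (f x - p x)\<^sup>2 \<partial>M) < e / 4"
    using f e unfolding polynomially_approximable_def by blast
  obtain q where q: "real_polynomial_function q" "in_L2 M q" "(\<integral>x. (g x - q x)\<^sup>2 \<partial>M) < e / 4"
    using g e unfolding polynomially_approximable_def by blast
  from integral_square_add_le[OF in_L2_diff[OF L2(1) p(2)] in_L2_diff[OF L2(2) q(2)]]
  have "(\<integral>x. (f x + g x - (p x + q x))\<^sup>2 \<partial>M) < e" using p(3) q(3) by (simp add: algebra_simps)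
  moreover have "real_polynomial_function (\<lambda>x. p x + q x)" using p(1) q(1) by blast
  ultimately show "\<exists>p. real_polynomial_function p \<and> in_L2 M p \<and> (\<integral>x. (f x + g x - p x)\<^sup>2 \<partial>M) < e"
    using in_L2_add[OF p(2) q(2)] by blast
qed

lemma polynomially_approximable_cmult:
  assumes f: "polynomially_approximable M f"
  shows "polynomially_approximable M (\<lambda>x. c * f x)"
  unfolding polynomially_approximable_def
proof (intro conjI allI impI)
  show "in_L2 M (\<lambda>x. c * f x)" using f by (auto simp: polynomially_approximable_def intro: in_L2_cmult)
  fix e :: real assume "e > 0"
  \<comment> \<open>The \<open>+ 1\<close> also covers \<open>c = 0\<close>.\<close>
  then have e: "e / (c\<^sup>2 + 1) > 0" by (simp add: add_nonneg_pos)
  obtain p where p: "real_polynomial_function p" "in_L2 M p" "(\<integral>x. (f x - p x)\<^sup>2 \<partial>M) < e / (c\<^sup>2 + 1)"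
    using f e unfolding polynomially_approximable_def by blast
  have "(\<integral>x. (c * f x - c * p x)\<^sup>2 \<partial>M) = c\<^sup>2 * (\<integral>x. (f x - p x)\<^sup>2 \<partial>M)"
    by (simp add: right_diff_distrib[symmetric] power_mult_distrib)
  also have "\<dots> \<le> c\<^sup>2 * (e / (c\<^sup>2 + 1))" using p(3) by (intro mult_left_mono) auto
  also have "\<dots> < e" using \<open>e > 0\<close> by (simp add: divide_less_eq add_nonneg_pos)
  finally show "\<exists>p. real_polynomial_function p \<and> in_L2 M p \<and> (\<integral>x. (c * f x - p x)\<^sup>2 \<partial>M) < e"
    using p in_L2_cmult by (intro exI[of _ "\<lambda>x. c * p x"]) auto
qed

text \<open>Dominated convergence, with bound \<open>4 * w^2\<close>, turns pointwise convergence
  into a vanishing squared error. The limits for closed sets, countable unions and general functions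
  all go through this rule.\<close>

lemma polynomially_approximable_LIMSEQ:
  assumes g: "\<And>n::nat. polynomially_approximable M (g n)"
    and f: "f \<in> borel_measurable M" and w: "in_L2 M w"
    and lim: "AE x in M. (\<lambda>n. g n x) \<longlonglongrightarrow> f x"
    and bound: "\<And>n. AE x in M. \<bar>g n x\<bar> \<le> w x"
  shows "polynomially_approximable M f"
proof (rule polynomially_approximable_closure)
  have [measurable]: "f \<in> borel_measurable M" "w \<in> borel_measurable M" "g n \<in> borel_measurable M" for n
    using f g w by (auto simp: polynomially_approximable_def in_L2_def)
  have bounds: "AE x in M. \<forall>n. \<bar>g n x\<bar> \<le> w x"
    using bound by (simp add: AE_all_countable)
  have bound_f: "AE x in M. \<bar>f x\<bar> \<le> w x"
    using lim bounds
  proof eventually_elim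
    case (elim x)
    then show ?case by (intro tendsto_upperbound[OF tendsto_rabs[OF elim(1)]]) auto
  qed
  have "AE x in M. norm ((f x)\<^sup>2) \<le> norm ((w x)\<^sup>2)"
    using bound_f by eventually_elim (simp add: abs_le_square_iff[symmetric])
  then show "in_L2 M f" using w unfolding in_L2_def
    by (auto intro: Bochner_Integration.integrable_bound)
  have "(\<lambda>n. \<integral>x. (f x - g n x)\<^sup>2 \<partial>M) \<longlonglongrightarrow> (\<integral>x. 0 \<partial>M)"
  proof (rule integral_dominated_convergence[where w = "\<lambda>x. 4 * (w x)\<^sup>2"])
    show "integrable M (\<lambda>x. 4 * (w x)\<^sup>2)" using w by (simp add: in_L2_def)
    show "AE x in M. (\<lambda>n. (f x - g n x)\<^sup>2) \<longlonglongrightarrow> 0"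
      using lim by eventually_elim (auto intro!: tendsto_eq_intros)
    show "AE x in M. norm ((f x - g n x)\<^sup>2) \<le> 4 * (w x)\<^sup>2" for n
      using bound_f bound[of n]
    proof eventually_elim
      case (elim x)
      then have "\<bar>f x - g n x\<bar> \<le> \<bar>2 * w x\<bar>" by linarith
      then show ?case by (simp add: abs_le_square_iff power_mult_distrib)
    qed
  qed auto
  then show "\<exists>h. polynomially_approximable M h \<and> (\<integral>x. (f x - h x)\<^sup>2 \<partial>M) < e" if "e > 0" for e
  proof -
    have "\<forall>\<^sub>F n in sequentially. (\<integral>x. (f x - g n x)\<^sup>2 \<partial>M) < e"
      using \<open>_ \<longlonglongrightarrow> (\<integral>x. 0 \<partial>M)\<close> that by (intro order_tendstoD(2)[of _ 0]) simp
    then show ?thesis using g by (auto simp: eventually_sequentially)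
  qed
qed

section \<open>From continuous functions to all of \<open>L^2\<close> over a measure carried by a
  compact set\<close>

context
  fixes M :: "'a::euclidean_space measure" and S :: "'a set"
  assumes finite: "finite_measure M" and sets_M: "sets M = sets borel"
    and S: "compact S" "AE x in M. x \<in> S"
begin

lemma in_L2_continuous:
  assumes "continuous_on UNIV f" shows "in_L2 M f"
proof -
  interpret finite_measure M by (rule finite)
  have "bounded (f ` S)"
    using S(1) assms by (intro compact_imp_bounded compact_continuous_image) (auto intro: continuous_on_subset)
  then obtain B where "\<And>x. x \<in> S \<Longrightarrow> \<bar>f x\<bar> \<le> B" by (auto simp: bounded_iff)
  moreover have "f \<in> borel_measurable M"
    using borel_measurable_continuous_onI[OF assms] measurable_cong_sets[OF sets_M refl] by auto
  ultimately show ?thesis using S(2) by (intro in_L2_AE_bounded[of f B]) auto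
qed

text \<open>Stone--Weierstrass gives a uniform error \<open>d\<close> on \<open>S\<close>, which
  carries \<open>M\<close>, hence a squared error of at most \<open>d^2\<close> times the total
  mass.\<close>

lemma polynomially_approximable_continuous:
  assumes f: "continuous_on UNIV f" shows "polynomially_approximable M f"
  unfolding polynomially_approximable_def
proof (intro conjI allI impI)
  interpret finite_measure M by (rule finite)
  show "in_L2 M f" using f by (rule in_L2_continuous)
  fix e :: real assume "e > 0"
  define m where "m = measure M (space M)"
  \<comment> \<open>With this \<open>d\<close>, \<open>m * d^2\<close> equals
    \<open>e * m / (2 * (m + 1))\<close>, which is below \<open>e\<close>; the \<open>+ 1\<close>
    also serves total mass 0.\<close>
  define d where "d = sqrt (e / (2 * (m + 1)))"
  have m: "m \<ge> 0" by (simp add: m_def)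
  have d: "d > 0" "d\<^sup>2 = e / (2 * (m + 1))" using \<open>e > 0\<close> m by (auto simp: d_def)
  obtain p where p: "real_polynomial_function p" "\<And>x. x \<in> S \<Longrightarrow> \<bar>f x - p x\<bar> < d"
    using Stone_Weierstrass_real_polynomial_function[OF S(1) continuous_on_subset[OF f] d(1)] by blast
  have p_L2: "in_L2 M p"
    using p(1) by (intro in_L2_continuous continuous_on_polymonial_function) (simp add: real_polynomial_function_eq)
  have "AE x in M. (f x - p x)\<^sup>2 \<le> d\<^sup>2"
    using S(2)
  proof eventually_elim
    case (elim x)
    from p(2)[OF this] d(1) show ?case by (simp add: abs_le_square_iff[symmetric])
  qed
  then have "(\<integral>x. (f x - p x)\<^sup>2 \<partial>M) \<le> (\<integral>x. d\<^sup>2 \<partial>M)"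
    using in_L2_diff[OF in_L2_continuous[OF f] p_L2] by (intro integral_mono_AE) (auto simp: in_L2_def)
  also have "\<dots> = m * d\<^sup>2" by (simp add: m_def)
  also have "\<dots> < e"
  proof -
    have "m * e < e * (2 * (m + 1))" using \<open>e > 0\<close> m
      by (simp add: algebra_simps add_nonneg_pos)
    then show ?thesis using m by (simp add: d field_simps)
  qed
  finally show "\<exists>p. real_polynomial_function p \<and> in_L2 M p \<and> (\<integral>x. (f x - p x)\<^sup>2 \<partial>M) < e"
    using p p_L2 by blast
qed

text \<open>Continuous tents of slope \<open>n\<close> around \<open>A\<close> decrease to the
  indicator: closedness makes the distance positive off \<open>A\<close>, so the tents are
  eventually 0 there.\<close>

lemma polynomially_approximable_indicator_closed:
  assumes "closed A" shows "polynomially_approximable M (indicator A)"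
\<comment> \<open>\<open>infdist x {}\<close> is 0 by convention, so for empty \<open>A\<close> the
  tents would be constantly 1.\<close>
proof (cases "A = {}")
  case True
  then show ?thesis using polynomially_approximable_continuous[of "\<lambda>_. 0"] by (simp add: indicator_def[abs_def])
next
  case False
  interpret finite_measure M by (rule finite)
  have lim: "(\<lambda>n. max 0 (1 - real n * infdist x A)) \<longlonglongrightarrow> indicator A x" for x
  proof (cases "x \<in> A")
    case False
    then have pos: "infdist x A > 0"
      using assms \<open>A \<noteq> {}\<close> infdist_pos_not_in_closed by blast
    obtain N where "real N * infdist x A > 1" using reals_Archimedean3[OF pos] by blast
    then have "real n * infdist x A > 1" if "n \<ge> N" for n
      using that pos by (meson less_le_trans mult_right_mono of_nat_mono less_imp_le)
    then have "\<forall>\<^sub>F n in sequentially. max 0 (1 - real n * infdist x A) = 0"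
      by (intro eventually_sequentiallyI[of N]) (auto simp: max_absorb1 less_imp_le)
    then show ?thesis using False by (simp add: tendsto_eventually)
  qed simp
  show ?thesis
  proof (rule polynomially_approximable_LIMSEQ)
    show "polynomially_approximable M (\<lambda>x. max 0 (1 - real n * infdist x A))" for n
      by (intro polynomially_approximable_continuous continuous_intros)
    show "indicator A \<in> borel_measurable M" 
      using assms by (intro borel_measurable_indicator) (simp add: sets_M)
    show "in_L2 M (\<lambda>_. 1)" by (intro in_L2_continuous continuous_intros)
    show "AE x in M. (\<lambda>n. max 0 (1 - real n * infdist x A)) \<longlonglongrightarrow> indicator A x"
      by (intro AE_I2 lim)
  qed (auto simp: infdist_nonneg)
qed

text \<open>Dynkin's pi-lambda argument: the closed sets are stable under intersection and generate
  the Borel sets, and approximability passes to complements and to disjoint countable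
  unions.\<close>

lemma polynomially_approximable_indicator:
  assumes "A \<in> sets M" shows "polynomially_approximable M (indicator A)"
proof -
  interpret finite_measure M by (rule finite)
  have sets_M': "sets M = sigma_sets UNIV (Collect closed)"
    by (simp add: sets_M borel_eq_closed)
  have "Int_stable (Collect closed :: 'a set set)" "Collect closed \<subseteq> Pow (UNIV :: 'a set)"
    "A \<in> sigma_sets UNIV (Collect closed)"
    using assms by (auto simp: Int_stable_def sets_M')
  then show ?thesis
  proof (induction A rule: sigma_sets_induct_disjoint)
    case (basic A)
    then show ?case by (auto intro: polynomially_approximable_indicator_closed)
  next
    case empty
    show ?case by (intro polynomially_approximable_indicator_closed) auto
  next
    case (compl A)
    have "polynomially_approximable M (\<lambda>x. indicator UNIV x + (-1) * indicator A x)"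
      by (intro polynomially_approximable_add polynomially_approximable_cmult
          polynomially_approximable_indicator_closed compl) auto
    also have "(\<lambda>x. indicator UNIV x + (-1) * indicator A x) = (indicator (UNIV - A) :: 'a \<Rightarrow> real)"
      by (auto simp: indicator_def)
    finally show ?case .
  next
    case (union A)
    have sum: "polynomially_approximable M (\<lambda>x. \<Sum>i<n. indicator (A i) x)" for n
    proof (induction n)
      case 0
      show ?case by (simp add: polynomially_approximable_continuous)
    next
      case (Suc n)
      then show ?case using polynomially_approximable_add[OF Suc union(3)[of n]] by simp
    qed
    \<comment> \<open>Disjointness makes the partial sums indicators again, so the constant 1
      dominates all of them.\<close>
    have ind: "(\<Sum>i<n. indicator (A i) x) = (indicator (\<Union>i<n. A i) x :: real)" for n x
      using union(1) by (intro indicator_UN_disjoint[symmetric]) (auto simp: disjoint_family_on_def)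
    show ?case
    proof (rule polynomially_approximable_LIMSEQ[OF sum[unfolded ind]])
      show "indicator (\<Union>i. A i) \<in> borel_measurable M" using union(2) by (intro borel_measurable_indicator sets.countable_UN) (simp add: sets_M')
      show "in_L2 M (\<lambda>_. 1)" by (intro in_L2_continuous continuous_intros)
      show "AE x in M. (\<lambda>n. indicator (\<Union>i<n. A i) x :: real) \<longlonglongrightarrow> indicator (\<Union>i. A i) x"
        by (intro AE_I2 LIMSEQ_indicator_UN)
    qed (auto simp: indicator_def)
  qed
qed

text \<open>Simple functions are finite combinations of indicators, and those converging to
  \<open>f\<close> can be chosen bounded by \<open>2 * \<bar>f\<bar>\<close>, which is in
  \<open>L^2\<close>.\<close>

theorem polynomials_dense_in_L2:
  assumes "in_L2 M f" shows "polynomially_approximable M f"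
proof -
  interpret finite_measure M by (rule finite)
  have [measurable]: "f \<in> borel_measurable M" using assms by (simp add: in_L2_def)
  obtain s where s: "\<And>i. simple_function M (s i)" "\<And>x. x \<in> space M \<Longrightarrow> (\<lambda>i. s i x) \<longlonglongrightarrow> f x"
    "\<And>i x. x \<in> space M \<Longrightarrow> dist (s i x) 0 \<le> 2 * dist (f x) 0"
    using borel_measurable_implies_sequence_metric[of f M 0] by fastforce
  have space_M: "space M = UNIV" using sets_eq_imp_space_eq[OF sets_M] by simp
  have simple: "polynomially_approximable M g" if "simple_function M g" for g
  proof -
    have "polynomially_approximable M (\<lambda>x. \<Sum>y\<in>Y. y * indicator (g -` {y} \<inter> space M) x)" if "finite Y" for Y
      using that
    proof (induction Y rule: finite_induct)
      case empty
      show ?case by (simp add: polynomially_approximable_continuous)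
    next
      case (insert y Y)
      have "g -` {y} \<inter> space M \<in> sets M"
        using \<open>simple_function M g\<close> by (rule simple_functionD)
      then show ?case
        unfolding sum.insert[OF insert(1,2)]
        by (intro polynomially_approximable_add polynomially_approximable_cmult
            polynomially_approximable_indicator insert(3))
    qed
    moreover have "finite (range g)" using that by (simp add: simple_function_def space_M)
    moreover have "(\<Sum>y\<in>range g. y * indicator (g -` {y} \<inter> space M) x) = g x" for x
    proof -
      have "(\<Sum>y\<in>range g. y * indicator (g -` {y} \<inter> space M) x) = (\<Sum>y\<in>range g. if g x = y then y else 0)"
        by (intro sum.cong) (auto simp: space_M indicator_def)
      then show ?thesis using \<open>finite (range g)\<close> by simp
    qed
    ultimately show ?thesis by (metis (no_types, lifting) ext)
  qed
  show ?thesis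
  proof (rule polynomially_approximable_LIMSEQ)
    show "polynomially_approximable M (s n)" for n by (intro simple s)
    show "in_L2 M (\<lambda>x. 2 * \<bar>f x\<bar>)" using assms by (intro in_L2_cmult) (auto simp: in_L2_def)
    show "AE x in M. (\<lambda>n. s n x) \<longlonglongrightarrow> f x" by (intro AE_I2 s)
    show "AE x in M. \<bar>s n x\<bar> \<le> 2 * \<bar>f x\<bar>" for n using s(3)[of _ n] by (intro AE_I2) simp
  qed simp
qed

end

subsection \<open>Measure-preserving maps of the torus\<close>

lemma space_circle [simp]: "space circle = {0..<1}"
  by (simp add: circle_def space_restrict_space)

lemma sets_circle: "A \<in> sets circle \<longleftrightarrow> A \<in> sets borel \<and> A \<subseteq> {0..<1}"
  by (auto simp: circle_def sets_restrict_space_iff)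

lemma emeasure_circle: "A \<in> sets circle \<Longrightarrow> emeasure circle A = emeasure lborel A"
  by (simp add: circle_def emeasure_restrict_space sets_restrict_space_iff)

lemma measurable_circleI: "f \<in> borel \<rightarrow>\<^sub>M N \<Longrightarrow> f \<in> circle \<rightarrow>\<^sub>M N"
  unfolding circle_def by (intro measurable_restrict_space1) simp

lemma emeasure_space_circle: "emeasure circle {0..<1} = 1"
  by (simp add: emeasure_circle sets_circle)

interpretation circle: finite_measure circle
  by standard (simp add: emeasure_space_circle)

interpretation circle_pair: pair_sigma_finite circle circle ..

interpretation torus: finite_measure torus
  unfolding torus_def by (intro finite_measure_pair_measure) unfold_locales

lemma measure_circle [simp]: "measure circle {0..<1} = 1"
  by (simp add: measure_def emeasure_space_circle)

lemma measure_torus [simp]: "measure torus ({0..<1} \<times> {0..<1}) = 1"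
proof -
  have "emeasure torus ({0..<1} \<times> {0..<1}) = 1 * 1"
    unfolding torus_def
    by (subst circle.emeasure_pair_measure_Times) (auto simp: sets_circle emeasure_space_circle)
  then show ?thesis by (simp add: measure_def)
qed

lemma space_torus [simp]: "space torus = {0..<1} \<times> {0..<1}"
  by (simp add: torus_def space_pair_measure)

lemma measurable_id_circle_borel [measurable]: "(\<lambda>x. x) \<in> circle \<rightarrow>\<^sub>M borel"
  by (rule measurable_circleI) simp

lemma borel_measurable_frac [measurable]: "(frac :: real \<Rightarrow> real) \<in> borel \<rightarrow>\<^sub>M borel"
  unfolding frac_def[abs_def]
  by (intro borel_measurable_diff borel_measurable_real_floor) simp

lemma measurable_frac_circle [measurable]: "frac \<in> borel \<rightarrow>\<^sub>M circle"
  unfolding circle_def by (intro measurable_restrict_space2) (auto simp: frac_lt_1)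

lemma emeasure_lborel_translate:
  fixes c :: real assumes "B \<in> sets borel"
  shows "emeasure lborel ((+) c -` B) = emeasure lborel B"
proof -
  have "emeasure (distr lborel borel ((+) c)) B = emeasure lborel ((+) c -` B)"
    using assms by (simp add: emeasure_distr)
  then show ?thesis by (simp add: lborel_distr_plus)
qed

text \<open>Only the fractional part \<open>c\<close> of \<open>a\<close> matters. It cuts the
  target at \<open>c\<close>: points that do not wrap around land in [c, 1), those that do land in
  [0, c), and each piece is pulled back by one translation of the line.\<close>

lemma distr_circle_rotation: "distr circle circle (\<lambda>s. frac (s + a)) = circle"
proof (rule measure_eqI)
  fix A assume "A \<in> sets (distr circle circle (\<lambda>s. frac (s + a)))"
  then have A: "A \<in> sets circle" and A': "A \<in> sets borel" "A \<subseteq> {0..<1}" by (auto simp: sets_circle)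
  have T[measurable]: "(\<lambda>s. frac (s + a)) \<in> circle \<rightarrow>\<^sub>M circle" by measurable
  define c where "c = frac a"
  have c: "0 \<le> c" "c < 1" by (auto simp: c_def frac_lt_1)
  have B: "A \<inter> {c..} \<in> sets borel" "A \<inter> {..<c} \<in> sets borel" using A' by auto
  have frac: "frac (s + a) = (if s + c < 1 then s + c else s + c - 1)" if "s \<in> {0..<1}" for s
    using that by (simp add: frac_add c_def)
  have eq: "(\<lambda>s. frac (s + a)) -` A \<inter> {0..<1} =
      ((+) c -` (A \<inter> {c..})) \<union> ((+) (c - 1) -` (A \<inter> {..<c}))" (is "?L = ?U \<union> ?V")
    using A'(2) c by (fastforce simp: frac add.commute algebra_simps split: if_splits)
  have "emeasure (distr circle circle (\<lambda>s. frac (s + a))) A = emeasure circle ?L"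
    by (simp add: emeasure_distr A)
  also have "\<dots> = emeasure lborel (?U \<union> ?V)"
    using measurable_sets[OF T A] by (simp add: emeasure_circle eq)
  also have "\<dots> = emeasure lborel ?U + emeasure lborel ?V"
  proof (rule plus_emeasure[symmetric])
    show "?U \<in> sets lborel" "?V \<in> sets lborel"
      using measurable_sets_borel[OF _ B(1), of "(+) c"] measurable_sets_borel[OF _ B(2), of "(+) (c - 1)"]
      by simp_all
  qed (auto dest!: subsetD[OF A'(2)])
  also have "\<dots> = emeasure lborel (A \<inter> {c..}) + emeasure lborel (A \<inter> {..<c})"
    using B by (simp only: emeasure_lborel_translate)
  also have "\<dots> = emeasure lborel ((A \<inter> {c..}) \<union> (A \<inter> {..<c}))"
    using B by (intro plus_emeasure) auto
  also have "(A \<inter> {c..}) \<union> (A \<inter> {..<c}) = A" by auto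
  finally show "emeasure (distr circle circle (\<lambda>s. frac (s + a))) A = emeasure circle A"
    using A by (simp add: emeasure_circle)
qed simp

section \<open>Measure-preserving rotations and shears\<close>

definition rotate :: "real \<Rightarrow> real \<Rightarrow> real \<times> real \<Rightarrow> real \<times> real" where
  "rotate a b = (\<lambda>(s, t). (frac (s + a), frac (t + b)))"

text \<open>Change between positions and lags: \<open>shear 1\<close> takes (s, lag) to (s, t), and
  \<open>shear (- 1)\<close> takes (s, t) to (s, lag).\<close>

definition shear :: "real \<Rightarrow> real \<times> real \<Rightarrow> real \<times> real" where
  "shear c = (\<lambda>(s, t). (s, frac (t + c * s)))"

lemma measurable_rotate [measurable]: "rotate a b \<in> torus \<rightarrow>\<^sub>M torus"
  unfolding rotate_def torus_def by measurable

lemma measurable_shear [measurable]: "shear c \<in> torus \<rightarrow>\<^sub>M torus"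
  unfolding shear_def torus_def by measurable

lemma distr_rotate: "distr torus torus (rotate a b) = torus"
proof -
  have "torus = distr circle circle (\<lambda>s. frac (s + a)) \<Otimes>\<^sub>M distr circle circle (\<lambda>s. frac (s + b))"
    by (simp only: distr_circle_rotation torus_def)
  also have "\<dots> = distr torus torus (rotate a b)"
    unfolding torus_def rotate_def
  proof (rule pair_measure_distr)
    show "sigma_finite_measure (distr circle circle (\<lambda>s. frac (s + b)))"
      by (simp only: distr_circle_rotation) unfold_locales
  qed measurable
  finally show ?thesis by simp
qed

text \<open>On the fibre over a fixed \<open>s\<close> the shear is the rotation by
  \<open>c * s\<close>, so Tonelli reduces the claim to rotation invariance of the circle.\<close>

lemma distr_shear: "distr torus torus (shear c) = torus"
proof (rule measure_eqI)
  fix A assume "A \<in> sets (distr torus torus (shear c))"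
  then have A[measurable]: "A \<in> sets torus" by simp
  then have A'[measurable]: "A \<in> sets (circle \<Otimes>\<^sub>M circle)" by (simp add: torus_def)
  have "emeasure (distr torus torus (shear c)) A = (\<integral>\<^sup>+x. indicator A x \<partial>distr torus torus (shear c))"
    by simp
  also have "\<dots> = (\<integral>\<^sup>+x. indicator A (shear c x) \<partial>torus)"
    by (rule nn_integral_distr) measurable
  also have "\<dots> = (\<integral>\<^sup>+s. \<integral>\<^sup>+t. indicator A (s, frac (t + c * s)) \<partial>circle \<partial>circle)"
    unfolding torus_def
    by (subst circle.nn_integral_fst[symmetric]) (auto simp: shear_def)
  also have "\<dots> = (\<integral>\<^sup>+s. \<integral>\<^sup>+t. indicator A (s, t) \<partial>circle \<partial>circle)"
  proof (rule nn_integral_cong)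
    fix s :: real assume [measurable]: "s \<in> space circle"
    have "(\<integral>\<^sup>+t. indicator A (s, t) \<partial>distr circle circle (\<lambda>t. frac (t + c * s))) =
        (\<integral>\<^sup>+t. indicator A (s, frac (t + c * s)) \<partial>circle)"
      by (rule nn_integral_distr) measurable
    then show "(\<integral>\<^sup>+t. indicator A (s, frac (t + c * s)) \<partial>circle) = (\<integral>\<^sup>+t. indicator A (s, t) \<partial>circle)"
      by (simp add: distr_circle_rotation)
  qed
  also have "\<dots> = (\<integral>\<^sup>+x. indicator A x \<partial>torus)"
    unfolding torus_def by (rule circle.nn_integral_fst) simp
  also have "\<dots> = emeasure torus A" by simp
  finally show "emeasure (distr torus torus (shear c)) A = emeasure torus A" .
qed simp

lemma distr_torus_AE:
  assumes "distr torus torus T = torus" "T \<in> torus \<rightarrow>\<^sub>M torus" "AE z in torus. P z"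
  shows "AE z in torus. P (T z)"
proof (rule AE_distrD[OF assms(2)])
  show "AE z in distr torus torus T. P z" unfolding assms(1) by (rule assms(3))
qed

lemma integral_torus_transform:
  fixes h :: "real \<times> real \<Rightarrow> 'b::{banach, second_countable_topology}"
  assumes "distr torus torus T = torus" "T \<in> torus \<rightarrow>\<^sub>M torus" "h \<in> borel_measurable torus"
  shows "(\<integral>z. h (T z) \<partial>torus) = (\<integral>z. h z \<partial>torus)"
  using integral_distr[OF assms(2,3)] assms(1) by simp

lemma in_L2_torus_transform:
  assumes "distr torus torus T = torus" "T \<in> torus \<rightarrow>\<^sub>M torus" "in_L2 torus f"
  shows "in_L2 torus (\<lambda>z. f (T z))"
proof -
  have "f \<in> borel_measurable torus" "integrable (distr torus torus T) (\<lambda>z. (f z)\<^sup>2)"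
    using assms by (auto simp: in_L2_def)
  then show ?thesis using integrable_distr[OF assms(2)] measurable_compose[OF assms(2)]
    by (auto simp: in_L2_def)
qed

subsection \<open>Fourier coefficients and Parseval's identity\<close>

definition torus_char :: "int \<times> int \<Rightarrow> real \<times> real \<Rightarrow> complex" where
  "torus_char = (\<lambda>(j, k) (s, t). cis (2 * pi * (of_int j * s + of_int k * t)))"

lemma norm_torus_char [simp]: "norm (torus_char x z) = 1"
  by (simp add: torus_char_def split_beta)

lemma torus_char_0 [simp]: "torus_char (0, 0) z = 1"
  by (simp add: torus_char_def split_beta)

lemma torus_char_mult: "torus_char x z * torus_char y z = torus_char (x + y) z"
  by (simp add: torus_char_def split_beta cis_mult algebra_simps)

lemma torus_char_add: "torus_char x (z + w) = torus_char x z * torus_char x w"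
  by (simp add: torus_char_def split_beta cis_mult algebra_simps)

lemma cnj_torus_char: "cnj (torus_char x z) = torus_char (- x) z"
proof -
  have "- (2 * pi * (of_int (fst x) * fst z + of_int (snd x) * snd z)) =
      2 * pi * (of_int (fst (- x)) * fst z + of_int (snd (- x)) * snd z)"
    by (simp add: algebra_simps)
  then show ?thesis by (simp only: torus_char_def split_beta cis_cnj)
qed

text \<open>Reduction modulo 1 moves a point by an integer vector; this lets characters ignore the
  \<open>frac\<close> in \<open>rotate\<close> and \<open>shear\<close>.\<close>

lemma torus_char_Ints:
  assumes "fst z \<in> \<int>" "snd z \<in> \<int>" shows "torus_char x z = 1"
proof -
  have "of_int (fst x) * fst z + of_int (snd x) * snd z \<in> \<int>" using assms by auto
  then show ?thesis by (simp add: torus_char_def split_beta cis_multiple_2pi)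
qed

lemma torus_char_rotate: "torus_char x (rotate a b z) = torus_char x (a, b) * torus_char x z"
proof -
  define w :: "real \<times> real" where "w = (- of_int \<lfloor>fst z + a\<rfloor>, - of_int \<lfloor>snd z + b\<rfloor>)"
  have "rotate a b z = (a, b) + z + w"
    by (cases z) (simp add: w_def rotate_def frac_def)
  moreover have "torus_char x w = 1" by (rule torus_char_Ints) (auto simp: w_def)
  ultimately show ?thesis by (simp add: torus_char_add)
qed

lemma measurable_torus_borel: "f \<in> borel_measurable borel \<Longrightarrow> f \<in> borel_measurable torus"
proof -
  have "(\<lambda>z. z) \<in> torus \<rightarrow>\<^sub>M (borel \<Otimes>\<^sub>M borel :: (real \<times> real) measure)"
    unfolding torus_def by (rule measurable_pair) (auto simp: comp_def intro!: measurable_compose[OF measurable_fst] measurable_compose[OF measurable_snd])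
  then show "f \<in> borel_measurable torus" if "f \<in> borel_measurable borel"
    using measurable_compose[of "\<lambda>z. z" torus borel f] that by (simp add: borel_prod)
qed

lemma measurable_torus_char [measurable]: "torus_char x \<in> borel_measurable torus"
  unfolding torus_char_def split_beta cis_conv_exp
  by (intro measurable_torus_borel borel_measurable_continuous_onI continuous_intros)

lemma measurable_cnj_torus_char [measurable]: "(\<lambda>z. cnj (torus_char x z)) \<in> borel_measurable torus"
  by (simp add: cnj_torus_char)

lemma integrable_torus_char: "integrable torus (torus_char x)"
  by (intro torus.integrable_const_bound[of _ 1]) auto

lemma integral_torus_char: "(\<integral>z. torus_char x z \<partial>torus) = (if x = (0, 0) then 1 else 0)"
proof (cases "x = (0, 0)")
  case False
  obtain j k where x: "x = (j, k)" by (cases x)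
  \<comment> \<open>Half a period along a coordinate with nonzero frequency gives the value
    -1.\<close>
  have "\<exists>a b. torus_char x (a, b) \<noteq> 1"
  proof (cases "j = 0")
    case True
    then have "torus_char x (0, 1 / (2 * of_int k)) = cis pi"
      using False x by (simp add: torus_char_def)
    then show ?thesis by (metis cis_pi one_neq_neg_one)
  next
    case False
    then have "torus_char x (1 / (2 * of_int j), 0) = cis pi"
      using x by (simp add: torus_char_def)
    then show ?thesis by (metis cis_pi one_neq_neg_one)
  qed
  then obtain a b where ab: "torus_char x (a, b) \<noteq> 1" by blast
  \<comment> \<open>Rotation invariance of the measure multiplies the integral by a number other than 1.\<close>
  have "(\<integral>z. torus_char x z \<partial>torus) = (\<integral>z. torus_char x (rotate a b z) \<partial>torus)"
    by (rule integral_torus_transform[symmetric]) (auto simp: distr_rotate)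
  also have "\<dots> = torus_char x (a, b) * (\<integral>z. torus_char x z \<partial>torus)"
    by (simp add: torus_char_rotate)
  finally show ?thesis using ab False by simp
qed (simp add: torus_char_def)

lemma has_integral_torus_char_orthonormal:
  "has_bochner_integral torus (\<lambda>z. torus_char x z * cnj (torus_char y z)) (if x = y then 1 else 0)"
proof -
  have "x + - y = (0, 0) \<longleftrightarrow> x = y"
    by (cases x; cases y) auto
  then show ?thesis
    using integrable_torus_char[of "x + - y"] integral_torus_char[of "x + - y"]
    unfolding cnj_torus_char torus_char_mult has_bochner_integral_iff by simp
qed

section \<open>Fourier coefficients and the mean-square error of trigonometric sums\<close>

definition fourier :: "(real \<times> real \<Rightarrow> real) \<Rightarrow> int \<times> int \<Rightarrow> complex" where
  "fourier f x = (\<integral>z. of_real (f z) * cnj (torus_char x z) \<partial>torus)"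

lemma fourier_coeff_eq_fourier: "fourier_coeff f j k = fourier f (j, k)"
proof -
  have "exp (- (2 * complex_of_real pi * \<i> * complex_of_real (of_int j * s + of_int k * t)))
      = cnj (torus_char (j, k) (s, t))" for s t
  proof -
    have "- (2 * complex_of_real pi * \<i> * complex_of_real (of_int j * s + of_int k * t))
        = \<i> * of_real (- (2 * pi * (of_int j * s + of_int k * t)))"
      by simp
    then show ?thesis by (simp only: torus_char_def prod.case cis_cnj cis_conv_exp[symmetric])
  qed
  then show ?thesis
    unfolding fourier_coeff_def fourier_def
    by (intro Bochner_Integration.integral_cong refl) (auto simp only: split_paired_all prod.case)
qed

lemma integrable_fourier:
  assumes "in_L2 torus f"
  shows "integrable torus (\<lambda>z. complex_of_real (f z) * torus_char x z)"
proof -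
  have [measurable]: "f \<in> borel_measurable torus" using assms by (simp add: in_L2_def)
  have bound: "norm (complex_of_real (f z) * torus_char x z) \<le> norm (1 + (f z)\<^sup>2)" for z
    by (simp add: norm_mult abs_le_one_plus_square)
  have "integrable torus (\<lambda>z. 1 + (f z)\<^sup>2)" using assms by (simp add: in_L2_def)
  then show ?thesis
    by (rule Bochner_Integration.integrable_bound) (measurable, intro AE_I2 bound)
qed

lemma has_integral_fourier:
  assumes "in_L2 torus f"
  shows "has_bochner_integral torus (\<lambda>z. of_real (f z) * cnj (torus_char x z)) (fourier f x)"
  using integrable_fourier[OF assms] by (simp add: fourier_def cnj_torus_char has_bochner_integral_iff)

lemma fourier_diff:
  assumes "in_L2 torus f" "in_L2 torus g"
  shows "fourier (\<lambda>z. f z - g z) x = fourier f x - fourier g x"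
  using has_bochner_integral_diff[OF has_integral_fourier[OF assms(1)] has_integral_fourier[OF assms(2)], of x x]
  by (auto simp: fourier_def has_bochner_integral_iff left_diff_distrib)

lemma fourier_sum:
  assumes "\<And>i. i \<in> I \<Longrightarrow> in_L2 torus (f i)"
  shows "fourier (\<lambda>z. \<Sum>i\<in>I. f i z) x = (\<Sum>i\<in>I. fourier (f i) x)"
proof -
  have "has_bochner_integral torus (\<lambda>z. \<Sum>i\<in>I. of_real (f i z) * cnj (torus_char x z)) (\<Sum>i\<in>I. fourier (f i) x)"
    using assms by (intro has_bochner_integral_sum has_integral_fourier)
  then show ?thesis by (auto simp: fourier_def has_bochner_integral_iff sum_distrib_right)
qed

lemma fourier_cmult: "fourier (\<lambda>z. c * f z) x = of_real c * fourier f x"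
  by (simp add: fourier_def mult.assoc)

text \<open>The change of variables pulls the constant \<open>cnj (torus_char x (a, b))\<close> out
  of the character. It has modulus 1, so multiplying by its conjugate isolates the rotated
  coefficient.\<close>

lemma fourier_rotate:
  assumes "in_L2 torus f"
  shows "fourier (\<lambda>z. f (rotate a b z)) x = torus_char x (a, b) * fourier f x"
proof -
  have [measurable]: "f \<in> borel_measurable torus" using assms by (simp add: in_L2_def)
  have unit: "cnj (torus_char x w) * torus_char x w = 1" for w
    using complex_norm_square[of "torus_char x w"] by (simp add: mult.commute)
  have "fourier f x = (\<integral>z. of_real (f (rotate a b z)) * cnj (torus_char x (rotate a b z)) \<partial>torus)"
    unfolding fourier_def
    by (rule integral_torus_transform[symmetric]) (auto simp: distr_rotate)
  also have "\<dots> = (\<integral>z. cnj (torus_char x (a, b)) * (of_real (f (rotate a b z)) * cnj (torus_char x z)) \<partial>torus)"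
    by (simp add: torus_char_rotate mult_ac)
  also have "\<dots> = cnj (torus_char x (a, b)) * fourier (\<lambda>z. f (rotate a b z)) x"
    by (simp add: fourier_def)
  finally have "torus_char x (a, b) * fourier f x =
      (cnj (torus_char x (a, b)) * torus_char x (a, b)) * fourier (\<lambda>z. f (rotate a b z)) x"
    by (simp only: mult_ac)
  then show ?thesis by (simp only: unit mult_1)
qed

text \<open>Pythagoras in \<open>L^2\<close>: expand the square, integrate by orthonormality and
  complete the square in each coefficient. The choice \<open>a = fourier f\<close> gives Bessel's
  inequality; a general \<open>a\<close> bounds the defect in that inequality by the error.\<close>

lemma integral_trigonometric_approximation:
  assumes f: "in_L2 torus f" and "finite F"
  shows "(\<integral>z. (cmod (of_real (f z) - (\<Sum>x\<in>F. a x * torus_char x z)))\<^sup>2 \<partial>torus) =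
    (\<integral>z. (f z)\<^sup>2 \<partial>torus) - (\<Sum>x\<in>F. (cmod (fourier f x))\<^sup>2) + (\<Sum>x\<in>F. (cmod (a x - fourier f x))\<^sup>2)"
    (is "(\<integral>z. ?h z \<partial>torus) = ?r")
proof -
  let ?e = torus_char and ?c = "fourier f"
  note f1 = has_integral_fourier[OF f]
  \<comment> \<open>\<open>f\<close> is real, so conjugation affects only the character and the
    coefficient.\<close>
  have f2: "has_bochner_integral torus (\<lambda>z. of_real (f z) * ?e x z) (cnj (?c x))" for x
    using has_bochner_integral_cnj[OF f1[of x]] by simp
  have f0: "has_bochner_integral torus (\<lambda>z. of_real ((f z)\<^sup>2)) (complex_of_real (\<integral>z. (f z)\<^sup>2 \<partial>torus))"
    using f by (intro has_bochner_integral_of_real) (auto simp: in_L2_def has_bochner_integral_iff)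
  have "has_bochner_integral torus
      (\<lambda>z. of_real ((f z)\<^sup>2) - (\<Sum>x\<in>F. cnj (a x) * (of_real (f z) * cnj (?e x z)))
        - (\<Sum>x\<in>F. a x * (of_real (f z) * ?e x z))
        + (\<Sum>x\<in>F. \<Sum>y\<in>F. a x * cnj (a y) * (?e x z * cnj (?e y z))))
      (of_real (\<integral>z. (f z)\<^sup>2 \<partial>torus) - (\<Sum>x\<in>F. cnj (a x) * ?c x)
        - (\<Sum>x\<in>F. a x * cnj (?c x))
        + (\<Sum>x\<in>F. \<Sum>y\<in>F. a x * cnj (a y) * (if x = y then 1 else 0)))"
    by (intro has_bochner_integral_add has_bochner_integral_diff has_bochner_integral_sum
        has_bochner_integral_mult_right f0 f1 f2 has_integral_torus_char_orthonormal)
  moreover have "of_real ((f z)\<^sup>2) - (\<Sum>x\<in>F. cnj (a x) * (of_real (f z) * cnj (?e x z)))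
        - (\<Sum>x\<in>F. a x * (of_real (f z) * ?e x z))
        + (\<Sum>x\<in>F. \<Sum>y\<in>F. a x * cnj (a y) * (?e x z * cnj (?e y z))) = of_real (?h z)" for z
  proof -
    define P where "P = (\<Sum>x\<in>F. a x * ?e x z)"
    have 1: "(\<Sum>x\<in>F. cnj (a x) * (of_real (f z) * cnj (?e x z))) = of_real (f z) * cnj P"
      by (simp add: P_def sum_distrib_left mult_ac)
    have 2: "(\<Sum>x\<in>F. a x * (of_real (f z) * ?e x z)) = of_real (f z) * P"
      by (simp add: P_def sum_distrib_left mult_ac)
    have 3: "(\<Sum>x\<in>F. \<Sum>y\<in>F. a x * cnj (a y) * (?e x z * cnj (?e y z))) = P * cnj P"
      by (simp add: P_def sum_product mult_ac)
    have "of_real (?h z) = (of_real (f z) - P) * cnj (of_real (f z) - P)"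
      unfolding P_def by (rule complex_norm_square)
    then show ?thesis unfolding 1 2 3 by (simp add: algebra_simps power2_eq_square)
  qed
  moreover have "of_real (\<integral>z. (f z)\<^sup>2 \<partial>torus) - (\<Sum>x\<in>F. cnj (a x) * ?c x)
        - (\<Sum>x\<in>F. a x * cnj (?c x))
        + (\<Sum>x\<in>F. \<Sum>y\<in>F. a x * cnj (a y) * (if x = y then 1 else 0)) = complex_of_real ?r"
  proof -
    have "(\<Sum>x\<in>F. \<Sum>y\<in>F. a x * cnj (a y) * (if x = y then 1 else 0)) = (\<Sum>x\<in>F. a x * cnj (a x))"
      using \<open>finite F\<close> by (intro sum.cong) (auto simp: if_distrib cong: if_cong)
    moreover have "(\<Sum>x\<in>F. a x * cnj (a x)) - (\<Sum>x\<in>F. cnj (a x) * ?c x) - (\<Sum>x\<in>F. a x * cnj (?c x)) =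
        (\<Sum>x\<in>F. of_real ((cmod (a x - ?c x))\<^sup>2)) - (\<Sum>x\<in>F. of_real ((cmod (?c x))\<^sup>2))"
      unfolding sum_subtractf[symmetric]
      by (intro sum.cong refl) (simp add: complex_norm_square algebra_simps del: of_real_power)
    ultimately show ?thesis by (simp add: algebra_simps)
  qed
  ultimately have "has_bochner_integral torus (\<lambda>z. complex_of_real (?h z)) (complex_of_real ?r)"
    by (simp only:)
  then have "(\<integral>z. complex_of_real (?h z) \<partial>torus) = complex_of_real ?r"
    by (simp only: has_bochner_integral_iff)
  then show ?thesis by (simp only: integral_complex_of_real of_real_eq_iff)
qed

section \<open>The algebra of trigonometric polynomials\<close>

definition trig_poly :: "(real \<times> real \<Rightarrow> complex) \<Rightarrow> bool" where
  "trig_poly h \<longleftrightarrow> (\<exists>F a. finite F \<and> (\<forall>z. h z = (\<Sum>x\<in>F. a x * torus_char x z)))"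

lemma trig_poly_char: "trig_poly (\<lambda>z. c * torus_char x z)"
  unfolding trig_poly_def by (intro exI[of _ "{x}"] exI[of _ "\<lambda>_. c"]) simp

lemma trig_poly_const: "trig_poly (\<lambda>z. c)"
  using trig_poly_char[of c "(0, 0)"] by simp

lemma trig_poly_add:
  assumes "trig_poly g" "trig_poly h" shows "trig_poly (\<lambda>z. g z + h z)"
proof -
  obtain F a where F: "finite F" "\<And>z. g z = (\<Sum>x\<in>F. a x * torus_char x z)"
    using assms(1) by (auto simp: trig_poly_def)
  obtain G b where G: "finite G" "\<And>z. h z = (\<Sum>x\<in>G. b x * torus_char x z)"
    using assms(2) by (auto simp: trig_poly_def)
  define c where "c x = (if x \<in> F then a x else 0) + (if x \<in> G then b x else 0)" for x
  have "g z + h z = (\<Sum>x\<in>F \<union> G. c x * torus_char x z)" for z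
  proof -
    have "g z = (\<Sum>x\<in>F \<union> G. (if x \<in> F then a x else 0) * torus_char x z)"
      unfolding F(2) using F(1) G(1) by (intro sum.mono_neutral_cong_left) auto
    moreover have "h z = (\<Sum>x\<in>F \<union> G. (if x \<in> G then b x else 0) * torus_char x z)"
      unfolding G(2) using F(1) G(1) by (intro sum.mono_neutral_cong_left) auto
    ultimately show ?thesis by (simp only: c_def distrib_right sum.distrib)
  qed
  then show ?thesis using F(1) G(1) unfolding trig_poly_def by (intro exI[of _ "F \<union> G"] exI[of _ c]) auto
qed

lemma trig_poly_sum: "(\<And>i. i \<in> I \<Longrightarrow> trig_poly (h i)) \<Longrightarrow> trig_poly (\<lambda>z. \<Sum>i\<in>I. h i z)"
  by (induction I rule: infinite_finite_induct) (auto intro: trig_poly_add trig_poly_const)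

lemma trig_poly_mult:
  assumes "trig_poly g" "trig_poly h" shows "trig_poly (\<lambda>z. g z * h z)"
proof -
  obtain F a where F: "finite F" "\<And>z. g z = (\<Sum>x\<in>F. a x * torus_char x z)"
    using assms(1) by (auto simp: trig_poly_def)
  obtain G b where G: "finite G" "\<And>z. h z = (\<Sum>x\<in>G. b x * torus_char x z)"
    using assms(2) by (auto simp: trig_poly_def)
  have "g z * h z = (\<Sum>x\<in>F. \<Sum>y\<in>G. (a x * b y) * torus_char (x + y) z)" for z
    by (simp add: F(2) G(2) sum_product torus_char_mult[symmetric] mult_ac)
  moreover have "trig_poly (\<lambda>z. \<Sum>x\<in>F. \<Sum>y\<in>G. (a x * b y) * torus_char (x + y) z)"
    by (intro trig_poly_sum trig_poly_char)
  ultimately show ?thesis by presburger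
qed

section \<open>Transfer of polynomial density through the embedding in
  \<open>\<complex> \<times> \<complex>\<close>\<close>

definition torus_embed :: "real \<times> real \<Rightarrow> complex \<times> complex" where
  "torus_embed = (\<lambda>(s, t). (cis (2 * pi * s), cis (2 * pi * t)))"

text \<open>Real-linear functionals and constants generate the polynomials, and trigonometric
  polynomials form an algebra, so the linear case decides. There the real and imaginary parts of
  \<open>cis\<close> are combinations of a character and its conjugate.\<close>

lemma trig_poly_polynomial:
  assumes "real_polynomial_function p"
  shows "trig_poly (\<lambda>z. of_real (p (torus_embed z)))"
  using assms
proof (induction p rule: real_polynomial_function.induct)
  case (linear p)
  then interpret bounded_linear p .
  \<comment> \<open>\<open>p\<close> is linear only over the reals, so it is determined by four
    values: at 1 and \<open>\<i>\<close> in each factor.\<close>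
  have p: "p (u, v) = Re u * p (1, 0) + Im u * p (\<i>, 0) + (Re v * p (0, 1) + Im v * p (0, \<i>))" for u v
  proof -
    have "(u, v) = Re u *\<^sub>R (1, 0) + Im u *\<^sub>R (\<i>, 0) + (Re v *\<^sub>R (0, 1) + Im v *\<^sub>R (0, \<i>))"
      by (auto simp: complex_eq_iff)
    then show ?thesis by (simp only: add scaleR) simp
  qed
  have cis_Re: "complex_of_real (Re (cis r)) = (cis r + cnj (cis r)) / 2"
    and cis_Im: "complex_of_real (Im (cis r)) = (cis r - cnj (cis r)) / (2 * \<i>)" for r
    by (simp_all add: complex_eq_iff)
  have char: "torus_char (1, 0) (s, t) = cis (2 * pi * s)" "torus_char (- 1, 0) (s, t) = cnj (cis (2 * pi * s))"
    "torus_char (0, 1) (s, t) = cis (2 * pi * t)" "torus_char (0, - 1) (s, t) = cnj (cis (2 * pi * t))" for s t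
    by (simp_all add: torus_char_def cis_cnj)
  have "of_real (p (torus_embed z)) =
      (p (1, 0) / 2 + p (\<i>, 0) / (2 * \<i>)) * torus_char (1, 0) z
    + (p (1, 0) / 2 - p (\<i>, 0) / (2 * \<i>)) * torus_char (-1, 0) z
    + ((p (0, 1) / 2 + p (0, \<i>) / (2 * \<i>)) * torus_char (0, 1) z
    + (p (0, 1) / 2 - p (0, \<i>) / (2 * \<i>)) * torus_char (0, -1) z)" for z
  proof -
    have "(x + y) / 2 * a + (x - y) / (2 * \<i>) * b = (a / 2 + b / (2 * \<i>)) * x + (a / 2 - b / (2 * \<i>)) * y"
      for x y a b :: complex
      by (simp add: ring_distribs add_divide_distrib diff_divide_distrib mult.commute)
    then show ?thesis
      by (cases z) (simp only: torus_embed_def prod.case p[of "cis _" "cis _"] char of_real_add of_real_mult of_real_divide of_real_numeral cis_Re cis_Im)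
  qed
  then show ?case
    by (simp only:) (intro trig_poly_add trig_poly_char)
qed (auto intro: trig_poly_const trig_poly_add trig_poly_mult)

text \<open>A Borel left inverse of the embedding on the fundamental domain. Since
  \<open>Im (Ln u)\<close> lies in (-pi, pi] for nonzero \<open>u\<close>, \<open>frac\<close>
  brings the angle into [0, 1).\<close>

definition torus_coords :: "complex \<times> complex \<Rightarrow> real \<times> real" where
  "torus_coords = (\<lambda>(u, v). (frac (Im (Ln u) / (2 * pi)), frac (Im (Ln v) / (2 * pi))))"

lemma torus_coords_embed:
  assumes "z \<in> {0..<1} \<times> {0..<1}" shows "torus_coords (torus_embed z) = z"
proof -
  have "frac (Im (Ln (cis (2 * pi * s))) / (2 * pi)) = s" if "s \<in> {0..<1}" for s
  proof -
    have "exp (Ln (cis (2 * pi * s))) = exp (\<i> * of_real (2 * pi * s))"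
      by (simp add: cis_conv_exp)
    then obtain n :: int where "Ln (cis (2 * pi * s)) = \<i> * of_real (2 * pi * s) + of_real (real_of_int (2 * n) * pi) * \<i>"
      unfolding exp_eq by blast
    then have "Im (Ln (cis (2 * pi * s))) / (2 * pi) = s + of_int n"
      by (simp add: field_simps)
    then show ?thesis using that by (simp add: frac_eq)
  qed
  then show ?thesis using assms by (auto simp: torus_coords_def torus_embed_def)
qed

lemma measurable_torus_embed [measurable]: "torus_embed \<in> torus \<rightarrow>\<^sub>M borel"
  unfolding torus_embed_def split_beta cis_conv_exp
  by (intro measurable_torus_borel borel_measurable_continuous_onI continuous_intros)

lemma measurable_torus_coords [measurable]: "torus_coords \<in> borel \<rightarrow>\<^sub>M torus"
  unfolding torus_coords_def torus_def borel_prod[symmetric] by measurable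

text \<open>Push the measure forward to the product of two unit circles and approximate there by a
  polynomial; composed with the embedding it becomes a trigonometric polynomial with the same
  \<open>L^2\<close> error.\<close>

lemma trig_polys_dense_in_L2:
  assumes f: "in_L2 torus f" and "e > 0"
  obtains F a where "finite F"
    "(\<integral>z. (cmod (of_real (f z) - (\<Sum>x\<in>F. a x * torus_char x z)))\<^sup>2 \<partial>torus) < e"
proof -
  define M where "M = distr torus borel torus_embed"
  \<comment> \<open>Composition with \<open>torus_coords\<close> gives a Borel function on the whole
    target space that returns \<open>f\<close> along the embedding.\<close>
  define g where "g = (\<lambda>w. f (torus_coords w))"
  have [measurable]: "f \<in> borel_measurable torus" using f by (simp add: in_L2_def)
  have g_meas [measurable]: "g \<in> borel_measurable borel" unfolding g_def by measurable
  have g: "g (torus_embed z) = f z" if "z \<in> space torus" for z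
    using that by (simp add: g_def torus_coords_embed)
  have finite: "finite_measure M" unfolding M_def by (intro torus.finite_measure_distr) simp
  have sphere: "AE w in M. w \<in> sphere 0 1 \<times> sphere 0 1"
    unfolding M_def
  proof (subst AE_distr_iff[OF measurable_torus_embed])
    have "closed (sphere 0 1 \<times> sphere 0 1 :: (complex \<times> complex) set)" by (intro closed_Times) auto
    then show "{w \<in> space borel. w \<in> sphere 0 1 \<times> sphere 0 1} \<in> sets (borel :: (complex \<times> complex) measure)"
      by simp
  qed (simp add: torus_embed_def split_beta)
  have "integrable torus (\<lambda>z. (g (torus_embed z))\<^sup>2)"
    using f by (subst Bochner_Integration.integrable_cong[where g = "\<lambda>z. (f z)\<^sup>2"]) (auto simp: g in_L2_def)
  then have "in_L2 M g"
    unfolding in_L2_def M_def by (simp add: integrable_distr_eq)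
  then have "polynomially_approximable M g"
    by (intro polynomials_dense_in_L2[OF finite _ _ sphere] compact_Times) (auto simp: M_def)
  then obtain p where p: "real_polynomial_function p" "in_L2 M p" "(\<integral>w. (g w - p w)\<^sup>2 \<partial>M) < e"
    using \<open>e > 0\<close> unfolding polynomially_approximable_def by blast
  have [measurable]: "p \<in> borel_measurable borel"
    using p(2) by (simp add: in_L2_def M_def)
  obtain F a where F: "finite F" "\<And>z. of_real (p (torus_embed z)) = (\<Sum>x\<in>F. a x * torus_char x z)"
    using trig_poly_polynomial[OF p(1)] by (auto simp: trig_poly_def)
  have "(\<integral>z. (cmod (of_real (f z) - (\<Sum>x\<in>F. a x * torus_char x z)))\<^sup>2 \<partial>torus)
      = (\<integral>z. (g (torus_embed z) - p (torus_embed z))\<^sup>2 \<partial>torus)"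
    by (intro Bochner_Integration.integral_cong refl)
       (simp only: g F(2)[symmetric] of_real_diff[symmetric] norm_of_real power2_abs)
  also have "\<dots> = (\<integral>w. (g w - p w)\<^sup>2 \<partial>M)"
    unfolding M_def by (rule integral_distr[symmetric]) measurable
  also have "\<dots> < e" by (rule p(3))
  finally show ?thesis by (rule that[OF F(1)])
qed

text \<open>Bessel bounds the finite partial sums by the squared norm, and density brings them
  arbitrarily close to it; for nonnegative terms the supremum of these sums is the sum.\<close>

theorem parseval:
  assumes f: "in_L2 torus f"
  shows "((\<lambda>x. (cmod (fourier f x))\<^sup>2) has_sum (\<integral>z. (f z)\<^sup>2 \<partial>torus)) UNIV"
proof -
  let ?c = "\<lambda>x. (cmod (fourier f x))\<^sup>2" and ?I = "\<integral>z. (f z)\<^sup>2 \<partial>torus"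
  have bessel: "sum ?c F \<le> ?I" if "finite F" for F
  proof -
    \<comment> \<open>The true coefficients as \<open>a\<close> make the last sum of the
      approximation identity vanish.\<close>
    have "0 \<le> (\<integral>z. (cmod (of_real (f z) - (\<Sum>x\<in>F. fourier f x * torus_char x z)))\<^sup>2 \<partial>torus)"
      by simp
    then show ?thesis unfolding integral_trigonometric_approximation[OF f that] by simp
  qed
  then have bdd: "bdd_above (sum ?c ` {F. F \<subseteq> UNIV \<and> finite F})"
    by (intro bdd_aboveI[of _ ?I]) auto
  have "(SUP F\<in>{F. finite F \<and> F \<subseteq> UNIV}. sum ?c F) = ?I"
  proof (rule antisym)
    show "(SUP F\<in>{F. finite F \<and> F \<subseteq> UNIV}. sum ?c F) \<le> ?I"
      by (rule cSUP_least) (auto intro: bessel)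
    show "?I \<le> (SUP F\<in>{F. finite F \<and> F \<subseteq> UNIV}. sum ?c F)"
    proof (rule field_le_epsilon)
      fix e :: real assume "e > 0"
      then obtain F a where F: "finite F"
          "(\<integral>z. (cmod (of_real (f z) - (\<Sum>x\<in>F. a x * torus_char x z)))\<^sup>2 \<partial>torus) < e"
        using trig_polys_dense_in_L2[OF f] by blast
      have "?I - sum ?c F < e"
        using F(2) unfolding integral_trigonometric_approximation[OF f F(1)]
        by (smt (verit) sum_nonneg zero_le_power2)
      moreover have "sum ?c F \<le> (SUP F\<in>{F. finite F \<and> F \<subseteq> UNIV}. sum ?c F)"
        using F(1) bdd by (intro cSUP_upper) (auto simp: conj_commute)
      ultimately show "?I \<le> (SUP F\<in>{F. finite F \<and> F \<subseteq> UNIV}. sum ?c F) + e" by simp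
    qed
  qed
  then show ?thesis using nonneg_bdd_above_has_sum[OF _ bdd] by simp
qed

lemma AE_zero_if_fourier_zero:
  assumes f: "in_L2 torus f" and "\<And>x. fourier f x = 0"
  shows "AE z in torus. f z = 0"
proof -
  have "(\<integral>z. (f z)\<^sup>2 \<partial>torus) = 0"
    using parseval[OF f] assms(2) has_sum_unique[OF _ has_sum_0] by fastforce
  then show ?thesis
    using f integral_nonneg_eq_0_iff_AE[of torus "\<lambda>z. (f z)\<^sup>2"] by (simp add: in_L2_def)
qed

subsection \<open>Diagonal averages and stationarity\<close>

lemma circle_periodic_add_int:
  assumes "circle_periodic g" shows "g (u + of_int n) = g u"
proof -
  have step: "g (u + 1) = g u" for u using assms by (simp add: circle_periodic_def)
  show ?thesis
  proof (induction n rule: int_induct[where k = 0])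
    case (step1 i)
    then show ?case using step[of "u + of_int i"] by (simp add: add.assoc)
  next
    case (step2 i)
    then show ?case using step[of "u + of_int (i - 1)"] by (simp add: algebra_simps)
  qed simp
qed

lemma circle_periodic_frac:
  assumes "circle_periodic g" shows "g (frac u) = g u"
  using circle_periodic_add_int[OF assms, of u "- \<lfloor>u\<rfloor>"] by (simp add: frac_def)

lemma torus_periodic_frac:
  assumes "torus_periodic F" shows "F (frac s, frac t) = F (s, t)"
proof -
  have "circle_periodic (\<lambda>u. F (u, v))" "circle_periodic (\<lambda>u. F (v, u))" for v
    using assms by (auto simp: torus_periodic_def circle_periodic_def)
  then show ?thesis using circle_periodic_frac[of "\<lambda>u. F (u, frac t)"] circle_periodic_frac[of "\<lambda>u. F (s, u)"]
    by simp
qed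

text \<open>Links translation on the line, as in \<open>diag_average\<close> and
  \<open>G_invariant\<close>, with a measure-preserving map of the fundamental domain.\<close>

lemma torus_periodic_rotate:
  assumes "torus_periodic F" shows "F (rotate a b (s, t)) = F (s + a, t + b)"
  by (simp add: rotate_def torus_periodic_frac[OF assms])

lemma torus_char_diagonal:
  "torus_char (j, k) (real_of_int l / real q, real_of_int l / real q) = cis (2 * pi * of_int (j + k) / real q) powi l"
  by (simp add: torus_char_def cis_power_int algebra_simps add_divide_distrib)

lemma cis_root_of_unity:
  assumes "q \<ge> 1"
  shows "cis (2 * pi * of_int m / real q) = 1 \<longleftrightarrow> int q dvd m"
proof
  assume "cis (2 * pi * of_int m / real q) = 1"
  then have "cos (2 * pi * of_int m / real q) = 1" by (simp add: complex_eq_iff)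
  then obtain n :: int where "2 * pi * of_int m / real q = of_int n * 2 * pi"
    using cos_one_2pi_int by blast
  then have "real_of_int m = of_int (n * int q)" using assms by (simp add: field_simps)
  then have "m = n * int q" by (simp only: of_int_eq_iff)
  then show "int q dvd m" by simp
next
  assume "int q dvd m"
  then obtain n where "m = int q * n" by blast
  then have "2 * pi * of_int m / real q = 2 * pi * of_int n" using assms by simp
  then show "cis (2 * pi * of_int m / real q) = 1" by (simp only: cis_multiple_2pi Ints_of_int)
qed

text \<open>A geometric sum over a \<open>q\<close>-th root of unity \<open>w\<close>:
  \<open>w = 1\<close> exactly when \<open>q\<close> divides \<open>j + k\<close>, and otherwise
  \<open>w^q = 1\<close> makes the sum vanish.\<close>

lemma sum_torus_char_diagonal:
  assumes "q \<ge> 1"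
  shows "(\<Sum>l<q. torus_char (j, k) (real l / real q, real l / real q)) = (if int q dvd j + k then of_nat q else 0)"
proof -
  define w where "w = cis (2 * pi * of_int (j + k) / real q)"
  have eq: "(\<Sum>l<q. torus_char (j, k) (real l / real q, real l / real q)) = (\<Sum>l<q. w ^ l)"
    using torus_char_diagonal[of j k "int _" q] by (simp add: w_def)
  show ?thesis
  proof (cases "int q dvd j + k")
    case True
    then have "w = 1" using assms by (simp only: w_def cis_root_of_unity)
    then show ?thesis using True by (simp add: eq)
  next
    case False
    then have "w \<noteq> 1" using assms by (simp only: w_def cis_root_of_unity) simp
    moreover have "w ^ q = 1"
    proof -
      have "real q * (2 * pi * of_int (j + k) / real q) = 2 * pi * of_int (j + k)"
        using assms by simp
      then show ?thesis by (simp only: w_def Complex.DeMoivre cis_multiple_2pi Ints_of_int)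
    qed
    ultimately show ?thesis using False by (simp add: eq geometric_sum)
  qed
qed

section \<open>The asymmetric part of a periodic square-integrable surface\<close>

context
  fixes C :: "real \<times> real \<Rightarrow> real"
  assumes periodic: "torus_periodic C" and L2: "in_L2 torus C"
begin

lemma in_L2_rotate: "in_L2 torus (\<lambda>z. C (rotate a b z))"
  by (rule in_L2_torus_transform[OF distr_rotate measurable_rotate L2])

lemma diag_average_eq_rotate:
  "diag_average q C z = (1 / real q) * (\<Sum>l<q. C (rotate (real l / real q) (real l / real q) z))"
  by (cases z) (simp add: diag_average_def torus_periodic_rotate[OF periodic])

lemma in_L2_asymmetric_part: "in_L2 torus (\<lambda>z. C z - diag_average q C z)"
  unfolding diag_average_eq_rotate by (intro in_L2_diff L2 in_L2_cmult in_L2_sum in_L2_rotate)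

text \<open>By \<open>fourier_rotate\<close>, averaging multiplies a coefficient by the mean of its
  character over the \<open>q\<close> diagonal shifts, which is 1 or 0.\<close>

lemma fourier_asymmetric_part:
  assumes "q \<ge> 1"
  shows "fourier (\<lambda>z. C z - diag_average q C z) (j, k) = (if int q dvd j + k then 0 else fourier C (j, k))"
proof -
  have "fourier (\<lambda>z. C z - diag_average q C z) (j, k) = fourier C (j, k)
      - of_real (1 / real q) * ((\<Sum>l<q. torus_char (j, k) (real l / real q, real l / real q)) * fourier C (j, k))"
    unfolding diag_average_eq_rotate
    by (subst fourier_diff[OF L2 in_L2_cmult[OF in_L2_sum[OF in_L2_rotate]]])
       (simp only: fourier_cmult fourier_sum[OF in_L2_rotate] fourier_rotate[OF L2] sum_distrib_right)
  then show ?thesis using assms by (simp add: sum_torus_char_diagonal)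
qed

lemma asymmetry_eq_integral: "asymmetry C q = (\<integral>z. (C z - diag_average q C z)\<^sup>2 \<partial>torus)"
  by (simp add: asymmetry_def L2_norm_def)

lemma has_sum_asymmetry:
  assumes "q \<ge> 1"
  shows "((\<lambda>x. (cmod (fourier C x))\<^sup>2) has_sum asymmetry C q) {(j, k). \<not> int q dvd (j + k)}"
proof -
  have "((\<lambda>x. (cmod (fourier (\<lambda>z. C z - diag_average q C z) x))\<^sup>2) has_sum asymmetry C q) UNIV"
    unfolding asymmetry_eq_integral by (rule parseval[OF in_L2_asymmetric_part])
  then show ?thesis
    by (rule has_sum_cong_neutral[THEN iffD1, rotated 3])
       (auto simp: fourier_asymmetric_part[OF assms] split: if_splits)
qed

text \<open>If the asymmetry vanishes, only coefficients with \<open>q\<close> dividing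
  \<open>j + k\<close> remain; the rotations fix those, and a function with zero coefficients is
  zero almost everywhere. Conversely, averaging an invariant surface changes it only on a null
  set.\<close>

lemma asymmetry_zero_iff_G_invariant:
  assumes q: "q \<ge> 1"
  shows "asymmetry C q = 0 \<longleftrightarrow> G_invariant q C"
proof
  assume zero: "asymmetry C q = 0"
  have c: "fourier C (j, k) = 0" if "\<not> int q dvd j + k" for j k
    using nonneg_has_sum_le_0D[OF has_sum_asymmetry[OF q], of "(j, k)"] zero that by simp
  show "G_invariant q C"
    unfolding G_invariant_def
  proof
    fix l :: int
    define a where "a = real_of_int l / real q"
    have "AE z in torus. C (rotate a a z) - C z = 0"
    proof (rule AE_zero_if_fourier_zero)
      show "in_L2 torus (\<lambda>z. C (rotate a a z) - C z)" by (intro in_L2_diff in_L2_rotate L2)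
      fix x :: "int \<times> int"
      obtain j k where x: "x = (j, k)" by (cases x)
      have "torus_char x (a, a) = 1" if "int q dvd j + k"
        using that cis_root_of_unity[OF q, of "j + k"] by (simp only: x a_def torus_char_diagonal) simp
      then show "fourier (\<lambda>z. C (rotate a a z) - C z) x = 0"
        using c[of j k] by (cases "int q dvd j + k")
          (simp_all add: fourier_diff[OF in_L2_rotate L2] fourier_rotate[OF L2] x)
    qed
    then show "AE (s, t) in torus. C (s + of_int l / real q, t + of_int l / real q) = C (s, t)"
      by (rule AE_mp) (auto simp: torus_periodic_rotate[OF periodic] a_def)
  qed
next
  assume inv: "G_invariant q C"
  have "AE (s, t) in torus. C (s + real l / real q, t + real l / real q) = C (s, t)" for l :: nat
    using inv[unfolded G_invariant_def, rule_format, of "int l"] by simp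
  \<comment> \<open>The shifts are countably many, so one null set serves for all of them.\<close>
  then have "AE z in torus. \<forall>l::nat. case z of (s, t) \<Rightarrow> C (s + real l / real q, t + real l / real q) = C (s, t)"
    unfolding AE_all_countable by blast
  then have "AE z in torus. (C z - diag_average q C z)\<^sup>2 = 0"
    by (rule AE_mp) (use q in \<open>auto simp: diag_average_def\<close>)
  then show "asymmetry C q = 0"
    unfolding asymmetry_eq_integral by (simp add: integral_eq_zero_AE)
qed

section \<open>Stationary surfaces and averages at fixed lag\<close>

lemma stationary_imp_G_invariant:
  assumes "stationary C" shows "G_invariant q C"
  unfolding G_invariant_def
proof
  fix l :: int
  define a where "a = real_of_int l / real q"
  obtain g where g: "circle_periodic g" "AE (s, t) in torus. C (s, t) = g (t - s)"
    using assms by (auto simp: stationary_def)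
  \<comment> \<open>Both coordinates shift by \<open>a\<close>, so the lag changes only by integer
    parts, which the period of \<open>g\<close> absorbs.\<close>
  have "g (frac (t + a) - frac (s + a)) = g (t - s)" for s t
    using circle_periodic_add_int[OF g(1), of "t - s" "\<lfloor>s + a\<rfloor> - \<lfloor>t + a\<rfloor>"]
    by (simp add: frac_def algebra_simps)
  then have "AE (s, t) in torus. C (s + a, t + a) = g (t - s)"
    using distr_torus_AE[OF distr_rotate measurable_rotate g(2), of a a]
    by (rule_tac AE_mp) (auto simp: rotate_def torus_periodic_frac[OF periodic])
  with g(2) show "AE (s, t) in torus. C (s + of_int l / real q, t + of_int l / real q) = C (s, t)"
    by eventually_elim (auto simp: a_def)
qed

text \<open>Mean of \<open>C\<close> over the pairs of lag \<open>u\<close>, the candidate for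
  \<open>g\<close> in \<open>stationary\<close>. The Bochner integral makes it total, with value 0
  where the fibre is not integrable.\<close>

definition lag_average :: "real \<Rightarrow> real" where
  "lag_average u = (\<integral>s. C (s, frac (u + s)) \<partial>circle)"

lemma measurable_lag_average [measurable]: "lag_average \<in> borel_measurable borel"
proof -
  have [measurable]: "C \<in> borel_measurable (circle \<Otimes>\<^sub>M circle)"
    using L2 by (simp add: in_L2_def torus_def)
  have "(\<lambda>(u, s). C (s, frac (u + s))) \<in> borel_measurable (borel \<Otimes>\<^sub>M circle)"
    by measurable
  then show ?thesis
    unfolding lag_average_def[abs_def] by (rule circle.borel_measurable_lebesgue_integral)
qed

lemma circle_periodic_lag_average: "circle_periodic lag_average"
proof -
  have "frac (u + 1 + s) = frac (u + s)" for u s :: real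
    using frac_1_eq[of "u + s"] by (simp add: add_ac)
  then show ?thesis by (simp add: circle_periodic_def lag_average_def)
qed

lemma in_L2_shear: "in_L2 torus (\<lambda>z. C (shear c z))"
  by (rule in_L2_torus_transform[OF distr_shear measurable_shear L2])

lemma lag_average_eq_shear: "lag_average u = (\<integral>s. C (shear 1 (s, u)) \<partial>circle)"
  by (simp add: lag_average_def shear_def)

text \<open>Fubini makes almost every fibre square-integrable; the fibrewise bound on the mean is
  then integrated over the lag, and the absent variable \<open>s\<close> ranges over a space of mass
  1.\<close>

lemma in_L2_lag_average: "in_L2 torus (\<lambda>z. lag_average (snd z))"
proof -
  let ?h = "\<lambda>s u. C (shear 1 (s, u))"
  have h: "in_L2 torus (\<lambda>(s, u). ?h s u)" using in_L2_shear[of 1] by (simp only: split_def prod.collapse)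
  have [measurable]: "(\<lambda>(s, u). ?h s u) \<in> borel_measurable (circle \<Otimes>\<^sub>M circle)"
    using h by (simp add: in_L2_def torus_def)
  have int: "integrable (circle \<Otimes>\<^sub>M circle) (\<lambda>(s, u). (?h s u)\<^sup>2)"
    using h unfolding in_L2_def torus_def split_def by blast
  have jensen: "AE u in circle. (lag_average u)\<^sup>2 \<le> (\<integral>s. (?h s u)\<^sup>2 \<partial>circle)"
    using circle_pair.AE_integrable_snd[OF int] AE_space
  proof eventually_elim
    case (elim u)
    then have u [measurable]: "u \<in> space circle" by simp
    have [measurable]: "(\<lambda>s. ?h s u) \<in> borel_measurable circle" by measurable
    have "integrable circle (\<lambda>s. 1 + (?h s u)\<^sup>2)" using elim(1) by simp
    then have ih: "integrable circle (\<lambda>s. ?h s u)"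
      by (rule Bochner_Integration.integrable_bound) (auto simp: abs_le_one_plus_square)
    define m where "m = lag_average u"
    \<comment> \<open>Jensen's inequality, as nonnegativity of the variance.\<close>
    have "0 \<le> (\<integral>s. (?h s u - m)\<^sup>2 \<partial>circle)" by simp
    also have "\<dots> = (\<integral>s. (?h s u)\<^sup>2 - 2 * m * ?h s u + m\<^sup>2 \<partial>circle)"
      by (simp add: power2_diff algebra_simps)
    also have "\<dots> = (\<integral>s. (?h s u)\<^sup>2 \<partial>circle) - 2 * m * m + m\<^sup>2"
      using elim(1) ih by (simp add: m_def lag_average_eq_shear)
    finally show ?case by (simp add: m_def power2_eq_square)
  qed
  have "integrable circle (\<lambda>u. \<integral>s. (?h s u)\<^sup>2 \<partial>circle)"
    by (rule circle_pair.integrable_snd[OF int])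
  then have int': "integrable circle (\<lambda>u. (lag_average u)\<^sup>2)"
    by (rule Bochner_Integration.integrable_bound) (use jensen in auto)
  have meas: "(\<lambda>z. lag_average (snd z)) \<in> borel_measurable torus"
    unfolding torus_def by measurable
  have "integrable (circle \<Otimes>\<^sub>M circle) (\<lambda>z. (lag_average (snd z))\<^sup>2)"
    by (rule circle_pair.Fubini_integrable) (use int' in auto)
  with meas show ?thesis by (simp add: in_L2_def torus_def)
qed

text \<open>\<open>(j - k) * s + k * (t + s) = j * s + k * t\<close>, and the shear preserves the
  measure. The indices \<open>j - k\<close> and \<open>k\<close> add up to \<open>j\<close>, so in
  lag coordinates the condition on the index sum becomes one on the first index alone.\<close>

lemma fourier_shear: "fourier (\<lambda>z. C (shear 1 z)) (j, k) = fourier C (j - k, k)"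
proof -
  have [measurable]: "C \<in> borel_measurable torus" using L2 by (simp add: in_L2_def)
  have char: "torus_char (j - k, k) (shear 1 z) = torus_char (j, k) z" for z
  proof -
    obtain s t where z: "z = (s, t)" by (cases z)
    define w :: "real \<times> real" where "w = (0, - of_int \<lfloor>t + s\<rfloor>)"
    have "shear 1 z = (s, t + s) + w" by (simp add: z w_def shear_def frac_def)
    moreover have "torus_char (j - k, k) w = 1" by (rule torus_char_Ints) (auto simp: w_def)
    ultimately show ?thesis by (simp add: torus_char_add) (simp add: torus_char_def z algebra_simps)
  qed
  have "fourier C (j - k, k) =
      (\<integral>z. of_real (C (shear 1 z)) * cnj (torus_char (j - k, k) (shear 1 z)) \<partial>torus)"
    unfolding fourier_def
    by (rule integral_torus_transform[symmetric]) (auto simp: distr_shear)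
  then show ?thesis by (simp add: fourier_def char)
qed

lemma fourier_lag_average:
  "fourier (\<lambda>z. lag_average (snd z)) (j, k) = (if j = 0 then fourier C (- k, k) else 0)"
proof (cases "j = 0")
  case False
  \<comment> \<open>Half a period in \<open>s\<close>: the function does not depend on
    \<open>s\<close>, so its coefficient equals its own negative.\<close>
  define a where "a = 1 / (2 * real_of_int j)"
  have char: "torus_char (j, k) (a, 0) = - 1"
    using False by (simp add: torus_char_def a_def)
  have "lag_average (snd (rotate a 0 z)) = lag_average (snd z)" for z
    by (simp add: rotate_def split_beta circle_periodic_frac[OF circle_periodic_lag_average])
  then show ?thesis
    using fourier_rotate[OF in_L2_lag_average, of a 0 "(j, k)"] False by (simp add: char)
next
  case True
  have char: "torus_char (0, k) (s, u) = torus_char (0, k) (0, u)" for s u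
    by (simp add: torus_char_def)
  \<comment> \<open>For first index 0 the character does not involve \<open>s\<close>, so the
    coefficient sees \<open>f\<close> only through its mean over \<open>s\<close>. The sheared
    \<open>C\<close> and its lag average share this mean.\<close>
  have fubini: "fourier f (0, k) = (\<integral>u. of_real (\<integral>s. f (s, u) \<partial>circle) * cnj (torus_char (0, k) (0, u)) \<partial>circle)"
    if f: "in_L2 torus f" for f
  proof -
    have f_char: "of_real (f z) * cnj (torus_char (0, k) z) =
        (case z of (s, u) \<Rightarrow> of_real (f (s, u)) * cnj (torus_char (0, k) (0, u)))" for z
    proof (cases z)
      case (Pair s u)
      then show ?thesis by (simp only: prod.case char[of s u])
    qed
    have "integrable (circle \<Otimes>\<^sub>M circle) (\<lambda>(s, u). of_real (f (s, u)) * cnj (torus_char (0, k) (0, u)))"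
      using has_integral_fourier[OF f, of "(0, k)"]
      unfolding f_char has_bochner_integral_iff torus_def by simp
    from circle_pair.integral_snd[OF this]
    have "(\<integral>u. \<integral>s. of_real (f (s, u)) * cnj (torus_char (0, k) (0, u)) \<partial>circle \<partial>circle)
      = (\<integral>z. (case z of (s, u) \<Rightarrow> of_real (f (s, u)) * cnj (torus_char (0, k) (0, u))) \<partial>torus)"
      by (simp add: torus_def)
    also have "\<dots> = fourier f (0, k)"
      by (simp only: fourier_def f_char)
    finally show ?thesis by simp
  qed
  have "fourier (\<lambda>z. lag_average (snd z)) (0, k) = fourier (\<lambda>z. C (shear 1 z)) (0, k)"
    unfolding fubini[OF in_L2_lag_average] fubini[OF in_L2_shear] lag_average_eq_shear[symmetric]
    by simp
  then show ?thesis using True by (simp add: fourier_shear)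
qed

text \<open>In lag coordinates \<open>C\<close> and its lag average have equal coefficients: those
  with nonzero first index vanish for both, and the others agree. Hence they coincide almost
  everywhere, and the inverse shear carries this back to (s, t).\<close>

lemma stationary_if_fourier_zero:
  assumes "\<And>j k. j + k \<noteq> 0 \<Longrightarrow> fourier C (j, k) = 0"
  shows "stationary C"
proof -
  have "AE z in torus. C (shear 1 z) - lag_average (snd z) = 0"
  proof (rule AE_zero_if_fourier_zero)
    show "in_L2 torus (\<lambda>z. C (shear 1 z) - lag_average (snd z))"
      by (intro in_L2_diff in_L2_shear in_L2_lag_average)
    fix x :: "int \<times> int"
    show "fourier (\<lambda>z. C (shear 1 z) - lag_average (snd z)) x = 0"
      using assms[of "fst x - snd x" "snd x"]
      by (cases x) (simp add: fourier_diff[OF in_L2_shear in_L2_lag_average] fourier_shear fourier_lag_average)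
  qed
  from distr_torus_AE[OF distr_shear measurable_shear this, of "- 1"]
  have "AE (s, t) in torus. C (s, t) = lag_average (t - s)"
  proof (rule AE_mp, intro AE_I2 impI)
    fix z assume z: "z \<in> space torus" "C (shear 1 (shear (- 1) z)) - lag_average (snd (shear (- 1) z)) = 0"
    obtain s t where st: "z = (s, t)" by (cases z)
    have "shear 1 (shear (- 1) z) = z" using z(1) by (auto simp: shear_def st)
    moreover have "lag_average (snd (shear (- 1) z)) = lag_average (t - s)"
      by (simp add: shear_def st circle_periodic_frac[OF circle_periodic_lag_average])
    ultimately show "case z of (s, t) \<Rightarrow> C (s, t) = lag_average (t - s)" using z(2) st by simp
  qed
  then show ?thesis
    unfolding stationary_def using measurable_lag_average circle_periodic_lag_average by blast
qed

end

section \<open>Divisibility order, limit in \<open>q\<close> and vanishing of the limit\<close>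

theorem proposition7p2:
  fixes C :: "real \<times> real \<Rightarrow> real"
  assumes "covariance_surface C"
  shows
    "(\<forall>q\<ge>1. ((\<lambda>(j, k). (cmod (fourier_coeff C j k))\<^sup>2) has_sum asymmetry C q)
              {(j, k). \<not> int q dvd (j + k)})
     \<and> (asymmetry C 1 = 0
        \<and> (\<forall>q\<ge>1. \<forall>q'\<ge>1. q dvd q' \<longrightarrow> asymmetry C q \<le> asymmetry C q'))
     \<and> (\<forall>q\<ge>1. asymmetry C q = 0 \<longleftrightarrow> G_invariant q C)
     \<and> ((\<lambda>(j, k). (cmod (fourier_coeff C j k))\<^sup>2) summable_on {(j, k). j + k \<noteq> 0}
        \<and> (\<forall>q\<ge>1. asymmetry C q \<le> asymmetry_limit C)
        \<and> (asymmetry C \<longlonglongrightarrow> asymmetry_limit C)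
        \<and> (asymmetry_limit C = 0 \<longleftrightarrow> stationary C))"
proof -
  have C: "torus_periodic C" "in_L2 torus C" using assms by (auto simp: covariance_surface_def)
  define v where "v x = (cmod (fourier C x))\<^sup>2" for x
  let ?S = "\<lambda>q. {(j, k). \<not> int q dvd (j + k)}" and ?T = "{(j, k). j + k \<noteq> (0::int)}"
  have v: "(\<lambda>(j, k). (cmod (fourier_coeff C j k))\<^sup>2) = v"
    by (auto simp: v_def fourier_coeff_eq_fourier)
  have nonneg: "0 \<le> v x" for x by (simp add: v_def)
  have sums: "(v has_sum asymmetry C q) (?S q)" if "q \<ge> 1" for q
    using has_sum_asymmetry[OF C that] by (simp add: v_def[abs_def])
  have one: "asymmetry C 1 = 0"
    using sums[of 1] has_sum_unique[OF _ has_sum_empty] by auto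
  have mono: "asymmetry C q \<le> asymmetry C q'" if "q \<ge> 1" "q' \<ge> 1" "q dvd q'" for q q'
  proof (rule has_sum_mono2[OF sums sums])
    \<comment> \<open>A multiple of \<open>q'\<close> is a multiple of \<open>q\<close>, so the
      index set grows along divisibility.\<close>
    show "?S q \<subseteq> ?S q'" using that(3) by (auto intro: dvd_trans)
  qed (use that nonneg in auto)
  have summable: "v summable_on ?T"
    using parseval[OF C(2)] summable_on_subset_banach[of v UNIV ?T]
    by (auto simp: v_def[abs_def] summable_on_def)
  then have limit: "(v has_sum asymmetry_limit C) ?T"
    unfolding asymmetry_limit_def v by (rule has_sum_infsum)
  have le: "asymmetry C q \<le> asymmetry_limit C" if "q \<ge> 1" for q
    by (rule has_sum_mono2[OF sums[OF that] limit]) (auto simp: nonneg)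
  \<comment> \<open>Divisibility does not order all \<open>q\<close> linearly, so convergence comes
    from a squeeze between a finite sum close to the limit and the upper bound
    \<open>le\<close>.\<close>
  have conv: "asymmetry C \<longlonglongrightarrow> asymmetry_limit C"
  proof (rule LIMSEQ_I)
    fix e :: real assume "e > 0"
    then obtain F where F: "finite F" "F \<subseteq> ?T" "dist (sum v F) (asymmetry_limit C) \<le> e / 2"
      using has_sum_finite_approximation[OF limit, of "e / 2"] by auto
    \<comment> \<open>Every \<open>q \<ge> N\<close> exceeds each \<open>\<bar>j + k\<bar>\<close>
      occurring in \<open>F\<close> and so cannot divide the nonzero \<open>j + k\<close>;
      \<open>Suc\<close> ensures \<open>q \<ge> 1\<close> even for empty \<open>F\<close>.\<close>
    define N where "N = Suc (\<Sum>(j, k)\<in>F. nat \<bar>j + k\<bar>)"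
    have "norm (asymmetry C q - asymmetry_limit C) < e" if "q \<ge> N" for q
    proof -
      have q: "q \<ge> 1" using that by (simp add: N_def)
      have "F \<subseteq> ?S q"
      proof
        fix x assume x: "x \<in> F"
        obtain j k where jk: "x = (j, k)" by (cases x)
        have "(case x of (j, k) \<Rightarrow> nat \<bar>j + k\<bar>) \<le> (\<Sum>(j, k)\<in>F. nat \<bar>j + k\<bar>)"
          using x F(1) by (intro member_le_sum) auto
        then have "\<bar>j + k\<bar> < int q" using that by (simp add: jk N_def)
        moreover have "j + k \<noteq> 0" using x F(2) jk by auto
        ultimately show "x \<in> ?S q" using zdvd_imp_le[of "int q" "\<bar>j + k\<bar>"] by (auto simp: jk)
      qed
      then have "sum v F \<le> asymmetry C q"
        by (intro has_sum_mono2[OF has_sum_finite[OF F(1)] sums[OF q]]) (auto simp: nonneg)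
      then show ?thesis using le[OF q] F(3) \<open>e > 0\<close> by (auto simp: dist_real_def)
    qed
    then show "\<exists>N. \<forall>q\<ge>N. norm (asymmetry C q - asymmetry_limit C) < e" by blast
  qed
  have "asymmetry_limit C = 0 \<longleftrightarrow> stationary C"
  proof
    assume "asymmetry_limit C = 0"
    then have "v (j, k) = 0" if "j + k \<noteq> 0" for j k
      using nonneg_has_sum_le_0D[OF limit _ nonneg, of "(j, k)"] that by simp
    then show "stationary C" using stationary_if_fourier_zero[OF C] by (simp add: v_def)
  next
    assume "stationary C"
    \<comment> \<open>Stationarity gives invariance for every \<open>q\<close>, so the sequence
      converging to \<open>asymmetry_limit C\<close> is 0 from \<open>q = 1\<close> on.\<close>
    then have "asymmetry C q = 0" if "q \<ge> 1" for q
      using asymmetry_zero_iff_G_invariant[OF C that] stationary_imp_G_invariant[OF C] by blast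
    then have "asymmetry C \<longlonglongrightarrow> 0"
      by (intro tendsto_eventually eventually_sequentiallyI[of 1]) auto
    then show "asymmetry_limit C = 0" by (rule LIMSEQ_unique[OF conv])
  qed
  then show ?thesis
    unfolding v using sums one mono asymmetry_zero_iff_G_invariant[OF C] summable le conv by blast
qed

end
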